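(* Let $E(z)=\exp(z)-2$ and $\widetilde{E}(z)=\exp(z)+\log(2\pi)+\frac{\pi}{2}i$, and let $I=\{z\in\mathbb{C}:E^n(z)\to\infty\}$ and $\widetilde{I}=\{z\in\mathbb{C}:\widetilde{E}^n(z)\to\infty\}$ be their escaping sets. Then the maps $E|_{I}$ and $\widetilde{E}|_{\widetilde{I}}$ are not topologically conjugate; that is, there is no homeomorphism $\Phi:I\to\widetilde{I}$ with $\Phi\circ E=\widetilde{E}\circ\Phi$ on $I$.
   Context: The sets $I,\widetilde I\subset\mathbb{C}$ carry the subspace topology. *)

theory Defs
  imports "HOL-Analysis.Analysis"
begin

definition exp_E :: "complex \<Rightarrow> complex" where
  "exp_E z = exp z - 2"

definition exp_E_tilde :: "complex \<Rightarrow> complex" where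
  "exp_E_tilde z = exp z + of_real (ln (2 * pi)) + of_real (pi / 2) * \<i>"

definition escaping_set :: "(complex \<Rightarrow> complex) \<Rightarrow> complex set" where
  "escaping_set f = {z. filterlim (\<lambda>n. (f ^^ n) z) at_infinity sequentially}"

(* Conjugacy of the restrictions f|S and g|T, for S forward invariant under f and T under g
   (as escaping sets are). The library's homeomorphism uses the subspace topologies on S and T,
   and the values of \<Phi> and \<Psi> outside S and T are irrelevant. *)
definition topologically_conjugate_on ::
  "complex set \<Rightarrow> (complex \<Rightarrow> complex) \<Rightarrow> complex set \<Rightarrow> (complex \<Rightarrow> complex) \<Rightarrow> bool" where
  "topologically_conjugate_on S f T g \<longleftrightarrow>
     (\<exists>\<Phi> \<Psi>. homeomorphism S T \<Phi> \<Psi> \<and> (\<forall>z\<in>S. \<Phi> (f z) = g (\<Phi> z)))"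

end

theory Submission
  imports Defs "HOL-Complex_Analysis.Complex_Analysis"
begin

text \<open>
  The orbits of \<open>E\<close> on the ray \<open>(-\<infinity>, -2]\<close> are bounded, so on \<open>I\<close> the principal branch of
  \<open>Ln (z + 2)\<close> is a continuous right inverse of \<open>E\<close>. A conjugacy carries it to a continuous right
  inverse of \<open>exp_E_tilde\<close>, that is, a continuous branch of the logarithm of \<open>z - v\<close> on the second
  escaping set, where \<open>v\<close> is the singular value. It extends to a neighbourhood of that set, which is
  impossible if \<open>{v}\<close> is a connected component of the set of non-escaping points.

  As \<open>v\<close> is mapped to the fixed point \<open>p = v + 2\<pi>i\<close>, it suffices by periodicity to treat \<open>p\<close>. The
  points whose orbits stay in the strip \<open>\<pi> \<le> Im z \<le> 3\<pi>\<close> form, apart from \<open>p\<close>, a set of escaping points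
  that contains an unbounded continuum landing at \<open>p\<close>. The preimage of its translate landing at \<open>v\<close>
  separates \<open>p\<close> from \<open>v\<close> and confines the component of \<open>p\<close> to a domain on which the inverse branch
  fixing \<open>p\<close> is a strict contraction of the hyperbolic metric; a point in this component whose orbit
  does not escape must therefore be \<open>p\<close>.
\<close>

section \<open>Logarithms and planar topology\<close>

text \<open>Around each \<open>z\<close> in \<open>S\<close> the principal logarithm of
  \<open>(w - v) / (z - v)\<close> continues the branch to a small disc. Continuity of
  \<open>s\<close> lets the radii be chosen so that these branches agree wherever the discs of half
  the radius overlap, and so they glue.\<close>

lemma continuous_log_open_extension:
  fixes v :: complex
  assumes cont: "continuous_on S s" and log: "\<And>z. z \<in> S \<Longrightarrow> exp (s z) = z - v"
  obtains U g where "open U" "S \<subseteq> U" "continuous_on U g" "\<And>z. z \<in> U \<Longrightarrow> exp (g z) = z - v"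
proof -
  have "\<exists>r>0. r \<le> norm (z - v) \<and> (\<forall>w\<in>S. dist w z < r \<longrightarrow> dist (s w) (s z) < 1)" if z: "z \<in> S" for z
  proof -
    obtain d where d: "d > 0" "\<forall>w\<in>S. dist w z < d \<longrightarrow> dist (s w) (s z) < 1"
      using cont[unfolded continuous_on_iff, rule_format, OF z zero_less_one] by blast
    have "z - v \<noteq> 0"
      using log[OF z] exp_not_eq_zero by metis
    then have "norm (z - v) > 0" by simp
    with d show ?thesis
      by (intro exI[of _ "min d (norm (z - v))"] conjI ballI impI) (simp_all only: min_less_iff_conj min.cobounded2)
  qed
  then obtain r where r: "\<And>z. z \<in> S \<Longrightarrow> r z > 0" "\<And>z. z \<in> S \<Longrightarrow> r z \<le> norm (z - v)"
    "\<And>z w. z \<in> S \<Longrightarrow> w \<in> S \<Longrightarrow> dist w z < r z \<Longrightarrow> dist (s w) (s z) < 1"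
    using bchoice[of S "\<lambda>z r. r > 0 \<and> r \<le> norm (z - v) \<and> (\<forall>w\<in>S. dist w z < r \<longrightarrow> dist (s w) (s z) < 1)"]
    by blast
  define b where "b z w = s z + Ln ((w - v) / (z - v))" for z w
  have Re_pos: "Re ((w - v) / (z - v)) > 0" if "z \<in> S" "dist w z < r z" for z w
  proof -
    have nz: "z \<noteq> v" using log[OF that(1)] by auto
    have "norm ((w - v) / (z - v) - 1) = norm (w - z) / norm (z - v)"
      using nz by (simp add: field_simps flip: norm_divide)
    also have "\<dots> < 1"
      using r(2)[OF that(1)] that(2) nz by (simp add: dist_norm)
    finally have "norm ((w - v) / (z - v) - 1) < 1" .
    then show ?thesis
      using abs_Re_le_cmod[of "(w - v) / (z - v) - 1"] by simp
  qed
  have exp_b: "exp (b z w) = w - v" if "z \<in> S" "dist w z < r z" for z w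
  proof -
    have "(w - v) / (z - v) \<noteq> 0" using Re_pos[OF that] by force
    then show ?thesis
      using log[OF that(1)] by (auto simp: b_def exp_add)
  qed
  \<comment> \<open>One centre lies in the full disc of the other, so the two values of
    \<open>s\<close> differ by less than 1. Together with two arguments below \<open>pi / 2\<close>
    in modulus this keeps the imaginary parts less than \<open>1 + pi < 2 * pi\<close>
    apart.\<close>
  have eq: "b z x = b w x" if "z \<in> S" "w \<in> S" "dist x z < r z / 2" "dist x w < r w / 2" for z w x
  proof -
    have *: "dist (s z) (s w) < 1"
    proof (cases "r w \<le> r z")
      case True
      then have "dist w z < r z"
        using that dist_triangle_half_r[of x w "r z" z] by simp
      then show ?thesis using r(3)[of z w] that by (simp add: dist_commute)
    next
      case False
      then have "dist z w < r w"
        using that dist_triangle_half_r[of x z "r w" w] by simp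
      then show ?thesis using r(3)[of w z] that by simp
    qed
    have near: "dist x z < r z" "dist x w < r w"
      using that r(1)[of z] r(1)[of w] by auto
    have "\<bar>Im (Ln u)\<bar> < pi / 2" if "Re u > 0" for u
      using that Re_Ln_pos_lt[of u] by (cases "u = 0") auto
    then have "\<bar>Im (Ln ((x - v) / (z - v)))\<bar> < pi / 2" "\<bar>Im (Ln ((x - v) / (w - v)))\<bar> < pi / 2"
      using Re_pos[OF that(1) near(1)] Re_pos[OF that(2) near(2)] by blast+
    moreover have "\<bar>Im (s z) - Im (s w)\<bar> < 1"
      using * abs_Im_le_cmod[of "s z - s w"] by (simp add: dist_norm)
    ultimately have "\<bar>Im (b z x) - Im (b w x)\<bar> < 2 * pi"
      using pi_gt3 unfolding b_def plus_complex.sel by linarith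
    then show ?thesis
      by (rule exp_complex_eqI) (simp only: exp_b that near)
  qed
  define U where "U = (\<Union>z\<in>S. ball z (r z / 2))"
  define c where "c x = (SOME z. z \<in> S \<and> dist x z < r z / 2)" for x
  have c: "c x \<in> S \<and> dist x (c x) < r (c x) / 2" if "x \<in> U" for x
    using that unfolding c_def U_def by (rule_tac someI_ex) (auto simp: dist_commute)
  define g where "g x = b (c x) x" for x
  have g_eq: "g x = b z x" if "z \<in> S" "x \<in> ball z (r z / 2)" for x z
  proof -
    have "x \<in> U" using that unfolding U_def by blast
    then show ?thesis
      using c[of x] that unfolding g_def by (rule_tac eq) (simp_all only: mem_ball dist_commute)
  qed
  show ?thesis
  proof
    show "open U" unfolding U_def by blast
    show "S \<subseteq> U" using r(1) unfolding U_def by force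
    show "exp (g z) = z - v" if "z \<in> U" for z
      using c[OF that] r(1)[of "c z"] unfolding g_def by (rule_tac exp_b) auto
    show "continuous_on U g" unfolding U_def
    proof (rule continuous_on_open_UN)
      fix z assume z: "z \<in> S"
      have "continuous_on (ball z (r z / 2)) (b z)"
        unfolding b_def
      proof (intro continuous_intros)
        fix w assume "w \<in> ball z (r z / 2)"
        then have "dist w z < r z"
          using r(1)[OF z] by (auto simp: dist_commute)
        from Re_pos[OF z this] show "(w - v) / (z - v) \<notin> \<real>\<^sub>\<le>\<^sub>0"
          by (auto simp: complex_nonpos_Reals_iff)
      qed (use log[OF z] in auto)
      then show "continuous_on (ball z (r z / 2)) g"
        by (rule continuous_on_eq) (simp_all add: g_eq[OF z])
    qed auto
  qed
qed

text \<open>If the point component \<open>{v}\<close> is separated from the rest of the closed complement by a clopen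
  piece \<open>K\<close>, dividing \<open>z - v\<close> by the exponential of the logarithm near \<open>K\<close> removes
  the zero at \<open>v\<close>, and the result contradicts the no-retraction theorem.\<close>

lemma no_continuous_log_around_singleton_component:
  fixes v :: complex
  assumes cont: "continuous_on S s" and log: "\<And>z. z \<in> S \<Longrightarrow> exp (s z) = z - v"
    and comp: "connected_component_set (- S) v = {v}"
  shows False
proof -
  obtain U g where U: "open U" "S \<subseteq> U" "continuous_on U g" "\<And>z. z \<in> U \<Longrightarrow> exp (g z) = z - v"
    using continuous_log_open_extension[OF cont log] by metis
  have v: "v \<in> - U"
    using U(4)[of v] by auto
  have "connected_component_set (- U) v \<subseteq> connected_component_set (- S) v"
    using U(2) by (intro connected_component_mono) auto
  with comp v have "connected_component_set (- U) v = {v}"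
    by (auto simp: connected_component_refl_eq)
  then have "{v} \<in> components (- U)"
    using v by (metis componentsI)
  moreover have "locally compact (- U)"
    using U(1) by (simp add: closed_imp_locally_compact closed_Compl)
  \<comment> \<open>Sura-Bura: a compact component of a locally compact set has arbitrarily small
    compact relatively clopen neighbourhoods.\<close>
  ultimately obtain K where K: "openin (top_of_set (- U)) K" "compact K" "{v} \<subseteq> K" "K \<subseteq> ball v 1"
    using Sura_Bura_clopen_subset[of "- U" "{v}" "ball v 1"] by auto
  define F where "F = (- U - K) \<union> - ball v 1"
  have "closedin (top_of_set (- U)) (- U - K)"
    using K(1) by (simp add: closedin_diff)
  then have "closed F"
    unfolding F_def using U(1) by (intro closed_Un) (auto intro: closedin_closed_trans)
  moreover have "F \<inter> K = {}"
    using K(4) by (auto simp: F_def)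
  ultimately obtain \<psi> :: "complex \<Rightarrow> real" where \<psi>: "continuous_on UNIV \<psi>"
      "\<And>x. x \<in> F \<Longrightarrow> \<psi> x = -1" "\<And>x. x \<in> K \<Longrightarrow> \<psi> x = 2"
    using Urysohn[of F K "-1::real" 2] K(2) compact_imp_closed by metis
  define \<theta> where "\<theta> z = max 0 (min 1 (\<psi> z))" for z
  have cont_\<theta>: "continuous_on UNIV \<theta>"
    unfolding \<theta>_def by (intro continuous_intros \<psi>)
  \<comment> \<open>As \<psi> is -1 on \<open>F\<close> and 2 on \<open>K\<close>, the clamped
    \<theta> is 0 near \<open>F\<close> and 1 near \<open>K\<close>. There \<open>h\<close> becomes
    \<open>z - v\<close> and 1 respectively, so the three cases fit together continuously.\<close>
  define h where "h z = (if z \<in> U then (z - v) * exp (- (of_real (\<theta> z) * g z)) else if z \<in> K then 1 else z - v)" for z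
  have h_F: "h z = z - v" if "\<psi> z < 0" for z
  proof -
    have "\<theta> z = 0" "z \<notin> K"
      using that \<psi>(3)[of z] by (auto simp: \<theta>_def)
    then show ?thesis by (auto simp: h_def)
  qed
  have h_K: "h z = 1" if "\<psi> z > 1" for z
  proof -
    have "\<theta> z = 1" "z \<notin> F"
      using that \<psi>(2)[of z] by (auto simp: \<theta>_def)
    then show ?thesis using U(4)[of z] v by (cases "z = v") (auto simp: h_def F_def exp_minus)
  qed
  have op: "open {z. \<psi> z < 0}" "open {z. \<psi> z > 1}"
    using \<psi>(1) by (auto intro!: open_Collect_less continuous_intros)
  have "continuous_on (U \<union> ({z. \<psi> z < 0} \<union> {z. \<psi> z > 1})) h"
  proof (intro continuous_on_open_Un U op open_Un)
    have "continuous_on U (\<lambda>z. (z - v) * exp (- (of_real (\<theta> z) * g z)))"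
      by (intro continuous_intros U continuous_on_subset[OF cont_\<theta>]) auto
    then show "continuous_on U h"
      by (rule continuous_on_eq) (auto simp: h_def)
    have "continuous_on {z. \<psi> z < 0} (\<lambda>z. z - v)" by (intro continuous_intros)
    then show "continuous_on {z. \<psi> z < 0} h"
      by (rule continuous_on_eq) (auto simp: h_F)
    have "continuous_on {z. \<psi> z > 1} (\<lambda>z. 1 :: complex)" by (intro continuous_intros)
    then show "continuous_on {z. \<psi> z > 1} h"
      by (rule continuous_on_eq) (auto simp: h_K)
  qed
  moreover have "U \<union> ({z. \<psi> z < 0} \<union> {z. \<psi> z > 1}) = UNIV"
    using \<psi>(2,3) by (force simp: F_def)
  ultimately have cont_h: "continuous_on UNIV h" by simp
  have h_nz: "h z \<noteq> 0" for z
    using v K(3) by (auto simp: h_def)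
  have h_out: "h z = z - v" if "dist v z = 1" for z
    using that \<psi>(2)[of z] by (intro h_F) (auto simp: F_def)
  have "frontier (cball v 1) retract_of cball v 1"
    unfolding retract_of_def retraction_def
  proof (intro exI conjI ballI)
    show "continuous_on (cball v 1) (\<lambda>z. v + sgn (h z))"
      using h_nz by (intro continuous_intros continuous_on_sgn continuous_on_subset[OF cont_h]) auto
    show "(\<lambda>z. v + sgn (h z)) \<in> cball v 1 \<rightarrow> frontier (cball v 1)"
      using h_nz by (auto simp: dist_norm norm_sgn)
    show "v + sgn (h z) = z" if "z \<in> frontier (cball v 1)" for z
    proof -
      have "dist v z = 1" using that by (simp add: frontier_cball)
      then show ?thesis using h_out[of z] by (simp add: sgn_div_norm dist_norm norm_minus_commute)
    qed
  qed auto
  then show False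
    using no_retraction_cball[of 1 v] by simp
qed

text \<open>A bounded component would have a compact relatively clopen neighbourhood, hence a
  bounded open neighbourhood \<open>U\<close> whose frontier misses the intersection. But every
  \<open>X n\<close> joins \<open>p\<close> to points outside \<open>U\<close>, so it meets the
  frontier, and compactness yields a common point there.\<close>

lemma unbounded_component_decreasing_Inter:
  fixes X :: "nat \<Rightarrow> 'a::euclidean_space set"
  assumes closed: "\<And>n. closed (X n)" and conn: "\<And>n. connected (X n)" and unb: "\<And>n. \<not> bounded (X n)"
    and dec: "\<And>n. X (Suc n) \<subseteq> X n" and p: "\<And>n. p \<in> X n"
  shows "\<not> bounded (connected_component_set (\<Inter>n. X n) p)"
proof
  let ?X = "\<Inter>n. X n" and ?C = "connected_component_set (\<Inter>n. X n) p"
  assume "bounded ?C"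
  have clX: "closed ?X" using closed by blast
  have "compact ?C"
    using \<open>bounded ?C\<close> clX by (simp add: compact_eq_bounded_closed closed_connected_component)
  moreover have C: "?C \<in> components ?X"
    using p by (intro componentsI) auto
  moreover obtain e where e: "?C \<subseteq> ball 0 e"
    using \<open>bounded ?C\<close> bounded_subset_ballD by blast
  ultimately obtain K where K: "openin (top_of_set ?X) K" "compact K" "?C \<subseteq> K" "K \<subseteq> ball 0 e"
    using Sura_Bura_clopen_subset[of ?X ?C "ball 0 e"] clX closed_imp_locally_compact by (metis open_ball)
  have "closedin (top_of_set ?X) (?X - K)"
    using K(1) by (simp add: closedin_diff)
  then have cl: "closed (?X - K)" using clX closedin_closed_trans by blast
  have disj: "K \<inter> ((?X - K) \<union> - ball 0 e) = {}"
    using K(4) by blast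
  obtain U V where UV: "open U" "open V" "K \<subseteq> U" "(?X - K) \<union> - ball 0 e \<subseteq> V" "U \<inter> V = {}"
    using separation_normal[of K "(?X - K) \<union> - ball 0 e"] disj K(2) cl
    by (auto simp: compact_imp_closed closed_Un closed_Compl)
  have pU: "p \<in> U"
    using K(3) UV(3) p by (force simp: connected_component_refl_eq)
  have Ub: "bounded U"
    by (rule bounded_subset[of "ball 0 e"]) (use UV in auto)
  define D where "D n = X n \<inter> frontier U" for n
  have "D n \<noteq> {}" for n
  proof -
    have "\<not> X n \<subseteq> U" using Ub unb bounded_subset by blast
    then show ?thesis
      unfolding D_def using connected_Int_frontier[OF conn[of n], of U] pU p by blast
  qed
  moreover have "compact (D n)" for n
    unfolding D_def using Ub closed by (simp add: compact_frontier_bounded closed_Int_compact)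
  moreover have "D n \<subseteq> D m" if "m \<le> n" for m n
    using lift_Suc_antimono_le[of X m n] dec that by (auto simp: D_def)
  ultimately have "(\<Inter>n. D n) \<noteq> {}"
    by (intro compact_nest) auto
  then obtain x where x: "x \<in> frontier U" "x \<in> ?X"
    by (auto simp: D_def)
  have "x \<notin> U" using x(1) UV(1) by (simp add: frontier_def interior_open)
  then have "x \<in> V" using x(2) UV(3,4) by blast
  moreover have "x \<in> closure U" using x(1) by (simp add: frontier_def)
  ultimately have "V \<inter> closure U \<noteq> {}" by blast
  then show False
    using open_Int_closure_eq_empty[OF UV(2), of U] UV(5) by blast
qed

text \<open>Connectedness of \<open>T\<close> makes the complement of \<open>C\<close> connected,
  and it is unbounded since it contains \<open>T\<close>. So \<open>C\<close> has no bounded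
  holes.\<close>

lemma simply_connected_component_of_complement:
  fixes T :: "complex set"
  assumes "closed T" "connected T" "\<not> bounded T" "C \<in> components (- T)"
  shows "simply_connected C"
proof -
  have "open C"
    using assms by (meson open_Compl open_components)
  moreover have "connected C"
    using assms in_components_connected by blast
  moreover have "connected (- C)"
    using assms by (rule_tac component_complement_connected)
  moreover have "\<not> bounded (- C)"
    using assms bounded_subset[of "- C" T] in_components_subset by blast
  moreover from this have "- C \<noteq> {}"
    using bounded_empty by metis
  ultimately have "components (- C) = {- C}"
    by (simp add: components_eq_sing_iff)
  then show ?thesis
    using \<open>open C\<close> \<open>connected C\<close> \<open>\<not> bounded (- C)\<close>
    by (simp add: simply_connected_eq_unbounded_complement_components)
qed

lemma convergent_subsequence_if_not_at_infinity:
  fixes w :: "nat \<Rightarrow> 'a::{real_normed_vector,heine_borel}"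
  assumes "\<not> filterlim w at_infinity sequentially"
  obtains r l where "strict_mono r" "(w \<circ> r) \<longlonglongrightarrow> l"
proof -
  obtain B where "\<exists>\<^sub>F n in sequentially. norm (w n) < B"
    using assms unfolding filterlim_at_infinity[OF order_refl]
    by (auto simp: not_eventually not_le)
  then have "infinite {n. norm (w n) < B}"
    by (simp add: frequently_cofinite flip: cofinite_eq_sequentially)
  then obtain q :: "nat \<Rightarrow> nat" where q: "strict_mono q" "\<And>n. norm (w (q n)) < B"
    using infinite_enumerate by blast
  have "bounded (range (w \<circ> q))"
    unfolding bounded_iff using q(2) less_imp_le by (auto intro!: exI[of _ B])
  then obtain l r where "strict_mono r" "((w \<circ> q) \<circ> r) \<longlonglongrightarrow> l"
    using bounded_imp_convergent_subsequence by blast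
  then show ?thesis
    using that[of "q \<circ> r" l] q(1) by (simp add: strict_mono_o comp_assoc)
qed

section \<open>Backward orbits of a non-surjective self-map\<close>

text \<open>In a disc coordinate centred at \<open>p\<close>, the Schwarz lemma makes the norms
  nondecreasing along a backward orbit. At an accumulation point the norm can no longer drop under
  \<open>G\<close>, which forces this point to be \<open>p\<close> and all the norms to be
  0.\<close>

lemma backward_orbit_of_self_map_eq_fixpoint:
  assumes V: "open V" "simply_connected V" "V \<noteq> UNIV"
    and G: "G holomorphic_on V" "G ` V \<subset> V" and p: "p \<in> V" "G p = p"
    and w: "\<And>n. w n \<in> V" "\<And>n. G (w (Suc n)) = w n"
    and r: "strict_mono r" "(w \<circ> r) \<longlonglongrightarrow> l" "l \<in> V"
  shows "w 0 = p"
proof -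
  obtain \<phi> \<psi> where \<phi>: "\<phi> holomorphic_on V" "\<psi> holomorphic_on ball 0 1"
      "\<And>z. z \<in> V \<Longrightarrow> \<phi> z \<in> ball 0 1" "\<And>z. z \<in> V \<Longrightarrow> \<psi> (\<phi> z) = z"
      "\<And>z. z \<in> ball 0 1 \<Longrightarrow> \<psi> z \<in> V" "\<And>z. z \<in> ball 0 1 \<Longrightarrow> \<phi> (\<psi> z) = z"
    using simply_connected_eq_biholomorphic_to_disc[OF V(1)] V(2,3) p(1) by blast
  obtain f g where f: "f (\<phi> p) = 0" "f holomorphic_on ball 0 1" "f ` ball 0 1 \<subseteq> ball 0 1"
      "g holomorphic_on ball 0 1" "g ` ball 0 1 \<subseteq> ball 0 1"
      "\<And>z. z \<in> ball 0 1 \<Longrightarrow> f (g z) = z" "\<And>z. z \<in> ball 0 1 \<Longrightarrow> g (f z) = z"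
    using ball_biholomorphism_exists[OF \<phi>(3)[OF p(1)]] by metis
  define \<Phi> where "\<Phi> = f \<circ> \<phi>"
  define \<Psi> where "\<Psi> = \<psi> \<circ> g"
  have \<Phi>: "\<Phi> z \<in> ball 0 1" "\<Psi> (\<Phi> z) = z" if "z \<in> V" for z
    using \<phi>(3,4)[OF that] f(3,7) unfolding \<Phi>_def \<Psi>_def by (auto simp: image_subset_iff)
  have \<Psi>: "\<Psi> u \<in> V" "\<Phi> (\<Psi> u) = u" if "u \<in> ball 0 1" for u
    using that \<phi>(5,6) f(5,6) unfolding \<Phi>_def \<Psi>_def by (auto simp: image_subset_iff)
  have hol: "\<Phi> holomorphic_on V" "\<Psi> holomorphic_on ball 0 1"
    unfolding \<Phi>_def \<Psi>_def using \<phi> f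
    by (auto intro!: holomorphic_on_compose_gen[where t = "ball 0 1"])
  define F where "F = \<Phi> \<circ> (G \<circ> \<Psi>)"
  have GV: "G z \<in> V" if "z \<in> V" for z using G(2) that by auto
  have F_hol: "F holomorphic_on ball 0 1"
    unfolding F_def using \<Psi>(1) GV hol G(1)
    by (intro holomorphic_on_compose_gen[where t = V]) auto
  have F_\<Phi>: "F (\<Phi> z) = \<Phi> (G z)" if "z \<in> V" for z
    using \<Phi>(2)[OF that] by (simp add: F_def)
  have \<Phi>p: "\<Phi> p = 0" using f(1) by (simp add: \<Phi>_def)
  have F0: "F 0 = 0" using F_\<Phi>[OF p(1)] p(2) \<Phi>p by simp
  have F_ball: "norm (F u) < 1" if "norm u < 1" for u
    using \<Phi>(1)[OF GV[OF \<Psi>(1)]] that by (simp add: F_def)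
  have le: "norm (F u) \<le> norm u" if "norm u < 1" for u
    using Schwarz_Lemma(1)[OF F_hol F0 F_ball that] by blast
  \<comment> \<open>Equality in the Schwarz lemma makes \<open>F\<close> a rotation, hence
    \<open>G\<close> surjective onto \<open>V\<close>.\<close>
  have strict: "u = 0" if u: "norm u < 1" "norm (F u) = norm u" for u
  proof (rule ccontr)
    assume "u \<noteq> 0"
    then obtain \<alpha> where \<alpha>: "\<And>z. norm z < 1 \<Longrightarrow> F z = \<alpha> * z" "norm \<alpha> = 1"
      using Schwarz_Lemma(3)[OF F_hol F0 F_ball u(1)] u by blast
    have "y \<in> G ` V" if y: "y \<in> V" for y
    proof -
      define t where "t = \<Phi> y / \<alpha>"
      have "\<alpha> \<noteq> 0" using \<alpha>(2) by auto
      then have t: "norm t < 1" "F t = \<Phi> y"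
        using \<Phi>(1)[OF y] \<alpha> by (auto simp: t_def norm_divide)
      then have "\<Psi> (F t) = y" using \<Phi>(2)[OF y] by simp
      moreover have "\<Psi> (F t) = G (\<Psi> t)"
        using \<Phi>(2)[OF GV[OF \<Psi>(1)], of t] t(1) by (simp add: F_def)
      ultimately show ?thesis using \<Psi>(1)[of t] t(1) by force
    qed
    then show False using G(2) by blast
  qed
  define a where "a n = norm (\<Phi> (w n))" for n
  have \<Phi>_w: "F (\<Phi> (w (Suc n))) = \<Phi> (w n)" for n
    using F_\<Phi>[OF w(1)[of "Suc n"]] w(2)[of n] by simp
  have a_Suc: "a n \<le> a (Suc n)" for n
    using le[of "\<Phi> (w (Suc n))"] \<Phi>(1)[OF w(1)[of "Suc n"]] unfolding a_def \<Phi>_w by simp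
  have a_mono: "a m \<le> a n" if "m \<le> n" for m n
    using lift_Suc_mono_le[of a] a_Suc that by blast
  have lim: "(\<lambda>n. \<Phi> (w (r n))) \<longlonglongrightarrow> \<Phi> l"
    using hol(1) V(1) r(2,3) w(1)
    by (intro continuous_on_tendsto_compose[of V \<Phi>])
       (auto simp: holomorphic_on_imp_continuous_on o_def)
  have lim_a: "(\<lambda>n. a (r n)) \<longlonglongrightarrow> norm (\<Phi> l)"
    unfolding a_def by (intro tendsto_norm lim)
  have "(\<lambda>n. F (\<Phi> (w (r (Suc n))))) \<longlonglongrightarrow> F (\<Phi> l)"
    using F_hol \<Phi>(1) r(3) w(1) LIMSEQ_Suc[OF lim]
    by (intro continuous_on_tendsto_compose[of "ball 0 1" F])
       (auto simp: holomorphic_on_imp_continuous_on)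
  then have lim_F: "(\<lambda>n. norm (F (\<Phi> (w (r (Suc n)))))) \<longlonglongrightarrow> norm (F (\<Phi> l))"
    by (rule tendsto_norm)
  \<comment> \<open>One application of \<open>F\<close> moves back a single index, from
    \<open>r (Suc n)\<close> to some \<open>m\<close> that is still at least
    \<open>r n\<close>.\<close>
  have "a (r n) \<le> norm (F (\<Phi> (w (r (Suc n)))))" for n
  proof -
    have "r n < r (Suc n)" using r(1) by (simp add: strict_mono_def)
    then obtain m where m: "r (Suc n) = Suc m" "r n \<le> m"
      by (cases "r (Suc n)") auto
    show ?thesis using a_mono[OF m(2)] unfolding m(1) \<Phi>_w by (simp add: a_def)
  qed
  then have "norm (\<Phi> l) \<le> norm (F (\<Phi> l))"
    by (intro LIMSEQ_le[OF lim_a lim_F]) auto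
  then have "\<Phi> l = 0"
    using le[of "\<Phi> l"] \<Phi>(1)[OF r(3)] strict[of "\<Phi> l"] by simp
  moreover have "a 0 \<le> norm (\<Phi> l)"
    using a_mono by (intro LIMSEQ_le_const[OF lim_a]) auto
  ultimately have "\<Phi> (w 0) = \<Phi> p" by (simp add: a_def \<Phi>p)
  then show ?thesis using \<Phi>(2) w(1) p(1) by metis
qed

section \<open>Escaping sets\<close>

lemma image_in_escaping_set_iff: "f z \<in> escaping_set f \<longleftrightarrow> z \<in> escaping_set f"
proof -
  have "z \<in> escaping_set f \<longleftrightarrow> filterlim (\<lambda>n. (f ^^ Suc n) z) at_infinity sequentially"
    unfolding escaping_set_def mem_Collect_eq
    using filterlim_sequentially_Suc[of "\<lambda>n. (f ^^ n) z" at_infinity] by blast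
  then show ?thesis
    by (simp add: escaping_set_def funpow_swap1)
qed

lemma bounded_orbit_not_escaping:
  assumes "\<And>n. norm ((f ^^ n) z) \<le> B"
  shows "z \<notin> escaping_set f"
proof
  assume "z \<in> escaping_set f"
  then have "\<forall>\<^sub>F n in sequentially. norm ((f ^^ n) z) \<ge> max 1 (B + 1)"
    unfolding escaping_set_def mem_Collect_eq filterlim_at_infinity[OF order_refl]
    by (metis less_max_iff_disj zero_less_one)
  then obtain n where "norm ((f ^^ n) z) \<ge> max 1 (B + 1)"
    by (meson eventually_happens trivial_limit_sequentially)
  with assms[of n] show False by simp
qed

section \<open>The ray landing at the singular value\<close>

text \<open>\<open>sv\<close> is the omitted value of \<open>exp_E_tilde\<close>, and \<open>fp\<close> the repelling fixed point it is mapped to.\<close>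

definition sv :: complex where
  "sv = of_real (ln (2 * pi)) + of_real (pi / 2) * \<i>"

definition fp :: complex where
  "fp = sv + of_real (2 * pi) * \<i>"

lemma exp_E_tilde_eq: "exp_E_tilde z = exp z + sv"
  by (simp add: exp_E_tilde_def sv_def)

lemma Im_sv [simp]: "Im sv = pi / 2" and Im_fp [simp]: "Im fp = 5 * pi / 2"
  by (simp_all add: sv_def fp_def)

lemma exp_2pi_i [simp]: "exp (of_real (2 * pi) * \<i>) = 1"
  by (metis exp_two_pi_i mult.commute of_real_mult of_real_numeral)

lemma exp_sv: "exp sv = of_real (2 * pi) * \<i>"
proof -
  have "exp (of_real (pi / 2) * \<i>) = \<i>"
    by (metis cis_conv_exp cis_pi_half mult.commute)
  then show ?thesis
    by (simp only: sv_def exp_add exp_of_real) simp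
qed

lemma exp_fp: "exp fp = of_real (2 * pi) * \<i>"
  by (simp only: fp_def exp_add exp_sv exp_2pi_i mult_1_right)

lemma exp_E_tilde_sv: "exp_E_tilde sv = fp" and exp_E_tilde_fp: "exp_E_tilde fp = fp"
  by (simp_all only: exp_E_tilde_eq exp_sv exp_fp) (simp_all add: fp_def add.commute)

lemma exp_E_tilde_periodic: "exp_E_tilde (z + of_real (2 * pi) * \<i>) = exp_E_tilde z"
  by (simp only: exp_E_tilde_eq exp_add exp_2pi_i mult_1_right)

lemma continuous_on_exp_E_tilde: "continuous_on A exp_E_tilde"
  unfolding exp_E_tilde_eq[abs_def] by (intro continuous_intros)

lemma escaping_set_periodic:
  "z + of_real (2 * pi) * \<i> \<in> escaping_set exp_E_tilde \<longleftrightarrow> z \<in> escaping_set exp_E_tilde"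
  using image_in_escaping_set_iff exp_E_tilde_periodic by metis

lemma fp_not_escaping: "fp \<notin> escaping_set exp_E_tilde"
proof (rule bounded_orbit_not_escaping)
  show "norm ((exp_E_tilde ^^ n) fp) \<le> norm fp" for n
    by (induction n) (simp_all add: exp_E_tilde_fp funpow_swap1 del: funpow.simps(2) add: funpow_Suc_right)
qed

lemma sv_not_escaping: "sv \<notin> escaping_set exp_E_tilde"
  using image_in_escaping_set_iff exp_E_tilde_sv fp_not_escaping by metis

section \<open>The strip around the fixed point and its inverse branch\<close>

definition strip :: "complex set" where
  "strip = {z. pi \<le> Im z \<and> Im z \<le> 3 * pi}"

text \<open>The shift by \<open>2 * pi\<close> selects the inverse branch of
  \<open>exp_E_tilde\<close> that fixes \<open>fp\<close> and maps the strip into itself.\<close>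

definition inv_branch :: "complex \<Rightarrow> complex" where
  "inv_branch z = Ln (z - sv) + of_real (2 * pi) * \<i>"

lemma fp_in_strip: "fp \<in> strip"
  using pi_gt_zero by (simp add: strip_def)

lemma convex_strip: "convex strip"
proof -
  have "strip = {z. pi \<le> Im z} \<inter> {z. Im z \<le> 3 * pi}" by (auto simp: strip_def)
  then show ?thesis using convex_Int[OF convex_halfspace_Im_ge[of pi] convex_halfspace_Im_le[of "3 * pi"]] by simp
qed

lemma closed_strip: "closed strip"
proof -
  have "strip = {z. Im z \<ge> pi} \<inter> {z. Im z \<le> 3 * pi}" by (auto simp: strip_def)
  then show ?thesis using closed_Int[OF closed_halfspace_Im_ge[of pi] closed_halfspace_Im_le[of "3 * pi"]] by simp
qed

lemma unbounded_strip: "\<not> bounded strip"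
proof
  assume "bounded strip"
  then obtain B where B: "\<And>z. z \<in> strip \<Longrightarrow> norm z \<le> B"
    unfolding bounded_iff by blast
  have "Complex (\<bar>B\<bar> + 1) pi \<in> strip" by (simp add: strip_def)
  from B[OF this] show False
    using abs_Re_le_cmod[of "Complex (\<bar>B\<bar> + 1) pi"] by simp
qed

lemma exp_E_tilde_inv_branch: "z \<noteq> sv \<Longrightarrow> exp_E_tilde (inv_branch z) = z"
  by (simp only: exp_E_tilde_eq inv_branch_def exp_add exp_2pi_i) simp

lemma Im_strip_minus_sv: "z \<in> strip \<Longrightarrow> pi / 2 \<le> Im (z - sv)"
  by (simp add: strip_def)

lemma strip_minus_sv_notin_nonpos_Reals: "z \<in> strip \<Longrightarrow> z - sv \<notin> \<real>\<^sub>\<le>\<^sub>0"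
  using Im_strip_minus_sv[of z] pi_gt_zero unfolding complex_nonpos_Reals_iff by linarith

lemma strip_neq_sv: "z \<in> strip \<Longrightarrow> z \<noteq> sv"
  using strip_minus_sv_notin_nonpos_Reals by force

lemma Im_inv_branch: "2 * pi < Im (inv_branch z)" "Im (inv_branch z) < 3 * pi" if "z \<in> strip"
proof -
  have "Im (z - sv) > 0"
    using Im_strip_minus_sv[OF that] pi_gt_zero by linarith
  then have "0 < Im (Ln (z - sv)) \<and> Im (Ln (z - sv)) < pi"
    using Im_Ln_pos_lt_imp by blast
  then show "2 * pi < Im (inv_branch z)" "Im (inv_branch z) < 3 * pi"
    by (simp_all add: inv_branch_def)
qed

lemma inv_branch_in_strip: "z \<in> strip \<Longrightarrow> inv_branch z \<in> strip"
  using Im_inv_branch[of z] pi_gt_zero unfolding strip_def mem_Collect_eq by linarith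

text \<open>The strict upper bound \<open>3 * pi\<close> for the branch removes the ambiguity of the
  logarithm even when \<open>Im z = pi\<close>.\<close>

lemma inv_branch_exp_E_tilde:
  assumes "z \<in> strip" "exp_E_tilde z \<in> strip"
  shows "inv_branch (exp_E_tilde z) = z"
proof (rule exp_complex_eqI)
  show "\<bar>Im (inv_branch (exp_E_tilde z)) - Im z\<bar> < 2 * pi"
    using Im_inv_branch[OF assms(2)] assms(1) unfolding strip_def mem_Collect_eq by linarith
  show "exp (inv_branch (exp_E_tilde z)) = exp z"
    using exp_E_tilde_inv_branch[OF strip_neq_sv[OF assms(2)]] by (simp add: exp_E_tilde_eq)
qed

text \<open>The derivative is \<open>1 / (u - sv)\<close>, and the convex strip stays at distance at
  least \<open>pi / 2\<close> from \<open>sv\<close>.\<close>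

lemma inv_branch_contraction:
  assumes "z \<in> strip" "w \<in> strip"
  shows "norm (inv_branch z - inv_branch w) \<le> 2 / pi * norm (z - w)"
proof (rule field_differentiable_bound[OF convex_strip _ _ assms])
  fix u assume u: "u \<in> strip"
  show "(inv_branch has_field_derivative 1 / (u - sv)) (at u within strip)"
    unfolding inv_branch_def using strip_minus_sv_notin_nonpos_Reals[OF u]
    by (auto intro!: derivative_eq_intros simp: inverse_eq_divide)
  have "norm (u - sv) \<ge> pi / 2"
    using Im_strip_minus_sv[OF u] abs_Im_le_cmod[of "u - sv"] by linarith
  moreover from this have "norm (u - sv) > 0"
    using pi_gt_zero by linarith
  ultimately show "norm (1 / (u - sv)) \<le> 2 / pi"
    using pi_gt_zero by (simp add: norm_divide field_simps)
qed

lemma continuous_on_inv_branch: "continuous_on strip inv_branch"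
  unfolding inv_branch_def
  using strip_minus_sv_notin_nonpos_Reals by (intro continuous_intros) auto

text \<open>\<open>exp_E_tilde\<close> expands the distance to \<open>fp\<close> by \<open>pi / 2\<close> in every step inside the strip.\<close>

lemma orbit_in_strip_escapes:
  assumes orb: "\<And>n. (exp_E_tilde ^^ n) z \<in> strip" and "z \<noteq> fp"
  shows "z \<in> escaping_set exp_E_tilde"
proof -
  let ?f = "exp_E_tilde"
  have step: "pi / 2 * norm (w - fp) \<le> norm (?f w - fp)" if "w \<in> strip" "?f w \<in> strip" for w
  proof -
    have "norm (w - fp) \<le> 2 / pi * norm (?f w - fp)"
      using inv_branch_contraction[OF that(2) fp_in_strip] inv_branch_exp_E_tilde[OF that]
        inv_branch_exp_E_tilde[of fp] fp_in_strip by (simp add: exp_E_tilde_fp)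
    then show ?thesis using pi_gt_zero by (simp add: field_simps)
  qed
  have lower: "(pi / 2) ^ n * norm (z - fp) \<le> norm ((?f ^^ n) z - fp)" for n
  proof (induction n)
    case (Suc n)
    have "(pi / 2) ^ Suc n * norm (z - fp) \<le> pi / 2 * norm ((?f ^^ n) z - fp)"
      using mult_left_mono[OF Suc, of "pi / 2"] by (simp add: mult.assoc)
    also have "\<dots> \<le> norm ((?f ^^ Suc n) z - fp)"
      using step[of "(?f ^^ n) z"] orb[of n] orb[of "Suc n"] by simp
    finally show ?case .
  qed simp
  have "filterlim (\<lambda>n. (pi / 2) ^ n) at_top sequentially"
    using pi_gt3
    by (intro filterlim_at_infinity_imp_filterlim_at_top filterlim_realpow_sequentially_gt1 always_eventually) auto
  then have "filterlim (\<lambda>n. norm (z - fp) * (pi / 2) ^ n) at_top sequentially"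
    using \<open>z \<noteq> fp\<close> by (intro filterlim_tendsto_pos_mult_at_top[OF tendsto_const]) auto
  then have "filterlim (\<lambda>n. norm ((?f ^^ n) z - fp)) at_top sequentially"
    by (rule filterlim_at_top_mono) (use lower in \<open>auto simp: mult.commute\<close>)
  then have "filterlim (\<lambda>n. (?f ^^ n) z - fp) at_infinity sequentially"
    by (rule filterlim_norm_at_top_imp_at_infinity)
  then have "filterlim (\<lambda>n. fp + ((?f ^^ n) z - fp)) at_infinity sequentially"
    by (rule tendsto_add_filterlim_at_infinity[OF tendsto_const])
  then show ?thesis by (simp add: escaping_set_def)
qed

text \<open>The ray is a translate of the component of \<open>fp\<close> in the set of points whose orbits never leave
  the strip.\<close>

lemma exists_ray_landing_at_sv:
  obtains \<gamma> where "closed \<gamma>" "connected \<gamma>" "\<not> bounded \<gamma>" "sv \<in> \<gamma>"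
    "\<gamma> - {sv} \<subseteq> escaping_set exp_E_tilde" "\<And>z. z \<in> \<gamma> \<Longrightarrow> exp_E_tilde z \<notin> \<gamma>"
proof -
  let ?f = "exp_E_tilde" and ?t = "of_real (2 * pi) * \<i>"
  define A where "A n = {z. \<forall>k\<le>n. (?f ^^ k) z \<in> strip}" for n
  have A_0: "A 0 = strip" by (simp add: A_def)
  have A_strip: "z \<in> strip" if "z \<in> A n" for z n
    using that unfolding A_def by force
  have A_image: "?f z \<in> A n" if "z \<in> A (Suc n)" for z n
    using that by (auto simp: A_def funpow_swap1 dest: spec[of _ "Suc _"])
  \<comment> \<open>Writing the sets as successive images of the strip makes their connectedness an
    easy induction.\<close>
  have A_Suc: "A (Suc n) = inv_branch ` A n" for n
  proof
    show "A (Suc n) \<subseteq> inv_branch ` A n"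
      using inv_branch_exp_E_tilde A_strip A_image by (metis image_eqI subsetI)
    show "inv_branch ` A n \<subseteq> A (Suc n)"
    proof
      fix z assume "z \<in> inv_branch ` A n"
      then obtain w where w: "w \<in> A n" "z = inv_branch w" by blast
      have "z \<in> strip" "?f z = w"
        using w A_strip inv_branch_in_strip exp_E_tilde_inv_branch strip_neq_sv by auto
      moreover have "(?f ^^ k) z = (case k of 0 \<Rightarrow> z | Suc j \<Rightarrow> (?f ^^ j) (?f z))" for k
        by (simp add: funpow_swap1 split: nat.split)
      ultimately show "z \<in> A (Suc n)"
        using w(1) by (auto simp: A_def split: nat.split)
    qed
  qed
  have sub: "A n \<subseteq> strip" for n using A_strip by blast
  define X where "X = (\<Inter>n. A n)"
  define C where "C = connected_component_set X fp"
  have fp_A: "fp \<in> A n" for n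
  proof -
    have "(?f ^^ k) fp = fp" for k
      by (induction k) (simp_all add: exp_E_tilde_fp)
    then show ?thesis using fp_in_strip by (simp add: A_def)
  qed
  have closed_A: "closed (A n)" for n
  proof -
    have "continuous_on UNIV (?f ^^ k)" for k
    proof (induction k)
      case (Suc k)
      then show ?case
        using continuous_on_compose[OF Suc continuous_on_exp_E_tilde] by simp
    qed (simp add: id_def)
    then have "closed (\<Inter>k\<in>{..n}. (?f ^^ k) -` strip)"
      using closed_strip by (intro closed_INT ballI closed_vimage)
    moreover have "A n = (\<Inter>k\<in>{..n}. (?f ^^ k) -` strip)"
      by (auto simp: A_def)
    ultimately show ?thesis by simp
  qed
  have conn_A: "connected (A n)" for n
  proof (induction n)
    case 0
    then show ?case by (simp add: A_0 convex_connected convex_strip)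
  next
    case (Suc n)
    then show ?case
      unfolding A_Suc
      by (intro connected_continuous_image continuous_on_subset[OF continuous_on_inv_branch] sub)
  qed
  \<comment> \<open>If \<open>A (Suc n)\<close> were bounded, the image of its compact closure would
    be a bounded set containing \<open>A n\<close>.\<close>
  have unb_A: "\<not> bounded (A n)" for n
  proof (induction n)
    case 0
    then show ?case by (simp add: A_0 unbounded_strip)
  next
    case (Suc n)
    show ?case
    proof
      assume "bounded (A (Suc n))"
      then have "bounded (closure (A (Suc n)))" by (rule bounded_closure)
      then have "compact (?f ` closure (A (Suc n)))"
        by (intro compact_continuous_image continuous_on_exp_E_tilde) (simp add: compact_eq_bounded_closed)
      moreover have "A n \<subseteq> ?f ` closure (A (Suc n))"
      proof
        fix w assume w: "w \<in> A n"
        have "?f (inv_branch w) = w"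
          by (rule exp_E_tilde_inv_branch[OF strip_neq_sv[OF A_strip[OF w]]])
        moreover have "inv_branch w \<in> closure (A (Suc n))"
          unfolding A_Suc by (intro subsetD[OF closure_subset] imageI w)
        ultimately show "w \<in> ?f ` closure (A (Suc n))" by (metis image_eqI)
      qed
      ultimately have "bounded (A n)"
        using compact_imp_bounded bounded_subset by metis
      with Suc show False by contradiction
    qed
  qed
  have C_unb: "\<not> bounded C"
    unfolding C_def X_def
    by (rule unbounded_component_decreasing_Inter[OF closed_A conn_A unb_A _ fp_A]) (auto simp: A_def)
  have C_X: "C \<subseteq> X" unfolding C_def by (rule connected_component_subset)
  have C_fp: "fp \<in> C" unfolding C_def X_def using fp_A by (simp add: connected_component_refl_eq)
  have C_closed: "closed C"
    unfolding C_def X_def using closed_A by (intro closed_connected_component closed_INT) auto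
  have X_f: "?f z \<in> X" if "z \<in> X" for z
    using that A_image unfolding X_def by (meson INT_I INT_D UNIV_I)
  have X_Im: "2 * pi < Im z" "Im z < 3 * pi" if "z \<in> X" for z
  proof -
    have "z \<in> inv_branch ` A 0" using that A_Suc[of 0] unfolding X_def by blast
    then show "2 * pi < Im z" "Im z < 3 * pi" using Im_inv_branch A_0 by auto
  qed
  have X_esc: "z \<in> escaping_set ?f" if "z \<in> X" "z \<noteq> fp" for z
    using that by (intro orbit_in_strip_escapes) (auto simp: X_def A_def)
  define \<gamma> where "\<gamma> = (+) (- ?t) ` C"
  have \<gamma>: "z \<in> \<gamma> \<longleftrightarrow> z + ?t \<in> C" for z
    unfolding \<gamma>_def by (auto simp: image_iff algebra_simps intro!: bexI[of _ "z + ?t"])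
  show ?thesis
  proof
    show "closed \<gamma>" unfolding \<gamma>_def using C_closed by (rule closed_translation)
    show "connected \<gamma>" unfolding \<gamma>_def C_def
      by (intro connected_continuous_image continuous_intros connected_connected_component)
    have "(+) ?t ` \<gamma> = C" by (simp add: \<gamma>_def image_image)
    then show "\<not> bounded \<gamma>" using C_unb bounded_translation by metis
    show "sv \<in> \<gamma>" using C_fp by (simp add: \<gamma> fp_def)
    show "\<gamma> - {sv} \<subseteq> escaping_set ?f"
    proof
      fix z assume z: "z \<in> \<gamma> - {sv}"
      then have "z + ?t \<in> escaping_set ?f"
        using C_X by (intro X_esc) (auto simp: \<gamma> fp_def)
      then show "z \<in> escaping_set ?f" by (simp only: escaping_set_periodic)
    qed
    \<comment> \<open>Points of \<gamma> have imaginary part below \<open>pi\<close>, while by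
      periodicity their images lie in \<open>X\<close>, above height \<open>2 * pi\<close>.\<close>
    show "?f z \<notin> \<gamma>" if "z \<in> \<gamma>" for z
    proof
      assume "?f z \<in> \<gamma>"
      then have "Im (?f z + ?t) < 3 * pi"
        using C_X X_Im(2) \<gamma> by blast
      moreover have "?f (z + ?t) \<in> X"
        using that C_X X_f \<gamma> by blast
      then have "2 * pi < Im (?f z)"
        using X_Im(1) by (simp only: exp_E_tilde_periodic)
      ultimately show False using pi_gt_zero by simp
    qed
  qed
qed

section \<open>Components of the non-escaping set\<close>

text \<open>The ray \<open>\<gamma>\<close> and its preimage consist of escaping points (up to \<open>sv\<close>), so they confine the
  component \<open>Q\<close> of non-escaping points to a domain \<open>W\<close> whose closure lies in the simply connected
  domain \<open>V\<close>, where the inverse branch \<open>Lg\<close> fixing \<open>fp\<close> is a non-surjective self-map.\<close>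

lemma connected_component_fp: "connected_component_set (- escaping_set exp_E_tilde) fp = {fp}"
proof -
  let ?f = "exp_E_tilde" and ?I = "escaping_set exp_E_tilde"
  obtain \<gamma> where \<gamma>: "closed \<gamma>" "connected \<gamma>" "\<not> bounded \<gamma>" "sv \<in> \<gamma>"
    "\<gamma> - {sv} \<subseteq> ?I" "\<And>z. z \<in> \<gamma> \<Longrightarrow> ?f z \<notin> \<gamma>"
    using exists_ray_landing_at_sv by metis
  have fp_image: "fp \<in> ?f ` A" if "fp \<in> A" for A
    using imageI[OF that, of ?f] by (simp add: exp_E_tilde_fp)
  have fp_\<gamma>: "fp \<notin> \<gamma>" using \<gamma>(6)[of fp] by (auto simp: exp_E_tilde_fp)
  define V where "V = connected_component_set (- \<gamma>) fp"
  have V_comp: "V \<in> components (- \<gamma>)"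
    unfolding V_def using fp_\<gamma> by (intro componentsI) simp
  have V: "open V" "connected V" "fp \<in> V" "V \<inter> \<gamma> = {}" "simply_connected V"
    using V_comp \<gamma>(1-3) fp_\<gamma> in_components_subset[OF V_comp]
    by (auto simp: V_def open_Compl open_connected_component connected_component_refl_eq
        simply_connected_component_of_complement)
  have into_V: "A \<subseteq> V" if "connected A" "fp \<in> A" "A \<inter> \<gamma> = {}" for A
    unfolding V_def using that by (intro connected_component_maximal) auto
  have "V \<noteq> UNIV" using V(4) \<gamma>(4) by auto
  have "(\<lambda>z. z - sv) holomorphic_on V" by (intro holomorphic_intros)
  moreover have "\<forall>z\<in>V. z - sv \<noteq> 0" using V(4) \<gamma>(4) by auto
  ultimately obtain g where g: "g holomorphic_on V" "\<And>z. z \<in> V \<Longrightarrow> z - sv = exp (g z)"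
    using V(5) unfolding simply_connected_eq_holomorphic_log[OF V(1)] by blast
  \<comment> \<open>The added constant normalises \<open>Lg fp = fp\<close>. Its exponential is 1
    because \<open>exp (g fp) = fp - sv = exp fp\<close>.\<close>
  define Lg where "Lg z = g z + (fp - g fp)" for z
  have Lg_hol: "Lg holomorphic_on V" unfolding Lg_def by (intro holomorphic_intros g)
  have Lg_fp: "Lg fp = fp" by (simp add: Lg_def)
  have f_Lg: "?f (Lg z) = z" if "z \<in> V" for z
  proof -
    have "exp (fp - g fp) = 1"
      using g(2)[OF V(3)] exp_fp by (simp add: exp_diff fp_def)
    then show ?thesis
      by (simp add: exp_E_tilde_eq Lg_def exp_add g(2)[OF that, symmetric])
  qed
  \<comment> \<open>On the connected set \<open>A\<close> the difference of \<open>Lg (?f z)\<close>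
    and \<open>z\<close> is continuous with values in the multiples of \<open>2 * pi * \<i>\<close>.
    So it is constant, and it vanishes at \<open>fp\<close>.\<close>
  have Lg_f: "Lg (?f z) = z" if A: "connected A" "fp \<in> A" "?f ` A \<inter> \<gamma> = {}" and z: "z \<in> A" for A z
  proof -
    have fA: "?f ` A \<subseteq> V"
      by (intro into_V connected_continuous_image continuous_on_exp_E_tilde A fp_image)
    define h where "h z = Lg (?f z) - z" for z
    have exp_h: "exp (h z) = 1" if "z \<in> A" for z
    proof -
      have "?f z \<in> V" using fA that by blast
      from f_Lg[OF this] show ?thesis by (simp add: h_def exp_diff exp_E_tilde_eq)
    qed
    have "continuous_on A h"
      unfolding h_def
      by (intro continuous_intros continuous_on_compose2[OF holomorphic_on_imp_continuous_on[OF Lg_hol]]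
          continuous_on_exp_E_tilde fA)
    moreover have "\<exists>e>0. \<forall>y. y \<in> A \<and> h y \<noteq> h x \<longrightarrow> e \<le> norm (h y - h x)" if x: "x \<in> A" for x
    proof (intro exI[of _ "2 * pi"] conjI allI impI)
      fix y assume y: "y \<in> A \<and> h y \<noteq> h x"
      then have "\<not> \<bar>Im (h y) - Im (h x)\<bar> < 2 * pi"
        using exp_complex_eqI[of "h y" "h x"] exp_h x by auto
      then show "2 * pi \<le> norm (h y - h x)"
        using abs_Im_le_cmod[of "h y - h x"] by simp
    qed simp
    ultimately have "h constant_on A"
      by (rule continuous_discrete_range_constant[OF A(1)])
    then have "h z = h fp" using z A(2) unfolding constant_on_def by metis
    then show ?thesis by (simp add: h_def exp_E_tilde_fp Lg_fp)
  qed
  have sv_notin: "sv \<notin> A" if "connected A" "fp \<in> A" "?f ` A \<inter> \<gamma> = {}" for A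
  proof
    assume "sv \<in> A"
    from Lg_f[OF that this] have "fp = sv" by (simp add: exp_E_tilde_sv Lg_fp)
    then show False by (simp add: fp_def)
  qed

  \<comment> \<open>The domain bounded by the preimage of the ray\<close>
  define W where "W = connected_component_set (- (?f -` \<gamma>)) fp"
  have op: "open (- (?f -` \<gamma>))"
    using \<gamma>(1) continuous_on_exp_E_tilde by (intro open_Compl closed_vimage)
  have fp_W: "fp \<in> W"
    unfolding W_def using fp_\<gamma> by (simp add: connected_component_refl_eq exp_E_tilde_fp)
  have W_sub: "W \<subseteq> - (?f -` \<gamma>)" unfolding W_def by (rule connected_component_subset)
  have W: "open W" "connected W" "?f ` W \<inter> \<gamma> = {}"
    using op W_sub by (auto simp: W_def open_connected_component)
  have into_W: "A \<subseteq> W" if "connected A" "fp \<in> A" "?f ` A \<inter> \<gamma> = {}" for A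
    unfolding W_def using that by (intro connected_component_maximal) auto
  have sv_W: "sv \<notin> W" using sv_notin[OF W(2) fp_W W(3)] .
  have comp_W: "connected_component_set (- (?f -` \<gamma>)) x = W" if "x \<in> W" for x
    using that connected_component_eq unfolding W_def by metis
  \<comment> \<open>The ray avoids its own preimage, so if it met the component \<open>W\<close> it
    would lie in it entirely, together with its endpoint \<open>sv\<close>.\<close>
  have W_\<gamma>: "x \<notin> \<gamma>" if "x \<in> W" for x
  proof
    assume "x \<in> \<gamma>"
    then have "\<gamma> \<subseteq> connected_component_set (- (?f -` \<gamma>)) x"
      using \<gamma>(2,6) by (intro connected_component_maximal) auto
    then show False using comp_W[OF that] sv_W \<gamma>(4) by blast
  qed
  \<comment> \<open>A point of \<gamma> lies in an open component of the same set as
    \<open>W\<close>. If it is adherent to \<open>W\<close>, the two components coincide.\<close>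
  have "closure W \<inter> \<gamma> = {}"
  proof (rule ccontr)
    assume "closure W \<inter> \<gamma> \<noteq> {}"
    then obtain x where x: "x \<in> closure W" "x \<in> \<gamma>" by blast
    let ?C = "connected_component_set (- (?f -` \<gamma>)) x"
    have "x \<in> ?C" using \<gamma>(6)[OF x(2)] by (simp add: connected_component_refl_eq)
    moreover have "open ?C" using op by (rule open_connected_component)
    ultimately have "?C \<inter> W \<noteq> {}"
      using x(1) open_Int_closure_eq_empty[of ?C W] by blast
    then obtain y where "y \<in> ?C" "y \<in> W" by blast
    then have "x \<in> W" using comp_W connected_component_eq \<open>x \<in> ?C\<close> by metis
    then show False using W_\<gamma> x(2) by blast
  qed
  then have clW: "closure W \<subseteq> V"
    using fp_W closure_subset W(2) by (intro into_V connected_imp_connected_closure) auto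
  have "Lg ` V \<subseteq> W"
  proof (rule into_W)
    show "connected (Lg ` V)"
      using Lg_hol V(2) by (intro connected_continuous_image holomorphic_on_imp_continuous_on)
    show "fp \<in> Lg ` V" using V(3) Lg_fp by (metis image_eqI)
    show "?f ` Lg ` V \<inter> \<gamma> = {}" using f_Lg V(4) by auto
  qed
  \<comment> \<open>Otherwise \<open>W\<close> would be clopen, hence the whole plane. This yields
    the non-surjectivity of \<open>Lg\<close> on \<open>V\<close>.\<close>
  moreover have "\<not> V \<subseteq> W"
  proof
    assume "V \<subseteq> W"
    then have "closure W \<subseteq> W" using clW by blast
    then have "closed W" using closure_subset_eq by blast
    then have "W = UNIV" using W(1) fp_W clopen by blast
    then show False using sv_W by simp
  qed
  ultimately have Lg_V: "Lg ` V \<subset> V"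
    using clW closure_subset[of W] by blast

  \<comment> \<open>The component of non-escaping points containing the fixed point\<close>
  define Q where "Q = connected_component_set (- ?I) fp"
  have Q: "connected Q" "fp \<in> Q" "Q \<subseteq> - ?I"
    unfolding Q_def using fp_not_escaping connected_component_subset
    by (auto simp: connected_component_refl_eq)
  have f_Q: "?f ` Q \<subseteq> Q"
  proof -
    have "?f ` Q \<subseteq> connected_component_set (- ?I) fp"
      using Q(3) image_in_escaping_set_iff[of ?f]
      by (intro connected_component_maximal connected_continuous_image continuous_on_exp_E_tilde Q fp_image) auto
    then show ?thesis by (simp add: Q_def)
  qed
  \<comment> \<open>Away from \<open>sv\<close> the ray escapes, and \<open>sv\<close> itself is an
    omitted value.\<close>
  have f_Q_\<gamma>: "?f ` Q \<inter> \<gamma> = {}"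
  proof -
    have "?f z \<noteq> sv" for z by (simp add: exp_E_tilde_eq)
    then show ?thesis using f_Q Q(3) \<gamma>(5) by blast
  qed
  have clQ: "closure Q \<subseteq> V"
    using closure_mono[OF into_W[OF Q(1,2) f_Q_\<gamma>]] clW by blast
  have "z = fp" if z: "z \<in> Q" for z
  proof -
    \<comment> \<open>The forward orbit of \<open>z\<close> is a backward orbit of
      \<open>Lg\<close>. Its accumulation point is only known to lie in \<open>closure Q\<close>, so
      this closure has to be contained in \<open>V\<close>.\<close>
    define w where "w n = (?f ^^ n) z" for n
    have w_Q: "w n \<in> Q" for n
      using z f_Q by (induction n) (auto simp: w_def)
    have "\<not> filterlim w at_infinity sequentially"
      using z Q(3) unfolding w_def by (auto simp: escaping_set_def)
    then obtain r l where r: "strict_mono r" "(w \<circ> r) \<longlonglongrightarrow> l"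
      using convergent_subsequence_if_not_at_infinity by blast
    have "l \<in> closure Q"
      using r(2) w_Q unfolding closure_sequential by (intro exI[of _ "w \<circ> r"]) auto
    moreover have "Lg (w (Suc n)) = w n" for n
      using Lg_f[OF Q(1,2) f_Q_\<gamma> w_Q[of n]] by (simp add: w_def)
    moreover have "w n \<in> V" for n
      using w_Q clQ closure_subset by blast
    ultimately have "w 0 = fp"
      using backward_orbit_of_self_map_eq_fixpoint[OF V(1,5) \<open>V \<noteq> UNIV\<close> Lg_hol Lg_V V(3) Lg_fp _ _ r]
        clQ by blast
    then show ?thesis by (simp add: w_def)
  qed
  then show ?thesis using Q(2) unfolding Q_def by blast
qed

text \<open>Translation by \<open>2 * pi * \<i>\<close> preserves the escaping set and carries
  \<open>sv\<close> to \<open>fp\<close>, hence the component of \<open>sv\<close> into that of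
  \<open>fp\<close>.\<close>

lemma connected_component_sv: "connected_component_set (- escaping_set exp_E_tilde) sv = {sv}"
proof -
  let ?I = "escaping_set exp_E_tilde" and ?t = "of_real (2 * pi) * \<i>"
  let ?C = "connected_component_set (- ?I) sv"
  have "(\<lambda>z. z + ?t) ` ?C \<subseteq> connected_component_set (- ?I) fp"
  proof (rule connected_component_maximal)
    show "fp \<in> (\<lambda>z. z + ?t) ` ?C"
      using sv_not_escaping by (auto simp: fp_def connected_component_refl_eq)
    show "connected ((\<lambda>z. z + ?t) ` ?C)"
      by (intro connected_continuous_image continuous_intros connected_connected_component)
    show "(\<lambda>z. z + ?t) ` ?C \<subseteq> - ?I"
      using connected_component_subset[of "- ?I" sv] escaping_set_periodic by blast
  qed
  then have "?C \<subseteq> {sv}"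
    unfolding connected_component_fp by (auto simp: fp_def)
  then show ?thesis
    using sv_not_escaping by (auto simp: connected_component_refl_eq)
qed

section \<open>Absence of a conjugacy\<close>

text \<open>The first step leads into the interval from -2 to 0, which \<open>exp_E\<close> maps
  into itself.\<close>

lemma exp_E_real_not_escaping:
  assumes "x \<le> -2"
  shows "of_real x \<notin> escaping_set exp_E"
proof -
  have exp_E_of_real: "exp_E (of_real y) = of_real (exp y - 2)" for y
    by (simp add: exp_E_def exp_of_real)
  have step: "-2 \<le> exp y - 2 \<and> exp y - 2 \<le> 0" if "y \<le> 0" for y :: real
    using that order_trans[of "exp y" 1 2] by simp
  have orb: "\<exists>y. (exp_E ^^ n) (exp_E (of_real x)) = of_real y \<and> -2 \<le> y \<and> y \<le> 0" for n
  proof (induction n)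
    case 0
    show ?case
      using assms by (intro exI[of _ "exp x - 2"] conjI step[THEN conjunct1] step[THEN conjunct2])
        (simp_all add: exp_E_of_real)
  next
    case (Suc n)
    then obtain y where y: "(exp_E ^^ n) (exp_E (of_real x)) = of_real y" "y \<le> 0" by blast
    then have "(exp_E ^^ Suc n) (exp_E (of_real x)) = of_real (exp y - 2)"
      by (simp add: exp_E_of_real)
    then show ?case using step[OF y(2)] by blast
  qed
  have "norm ((exp_E ^^ n) (exp_E (of_real x))) \<le> 2" for n
    using orb[of n] by auto
  then have "exp_E (of_real x) \<notin> escaping_set exp_E"
    by (rule bounded_orbit_not_escaping)
  then show ?thesis by (simp only: image_in_escaping_set_iff not_False_eq_True)
qed

lemma escaping_exp_E_plus_2_notin_nonpos_Reals:
  assumes "z \<in> escaping_set exp_E"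
  shows "z + 2 \<notin> \<real>\<^sub>\<le>\<^sub>0"
proof
  assume "z + 2 \<in> \<real>\<^sub>\<le>\<^sub>0"
  then have "z = of_real (Re z)" "Re z \<le> -2"
    by (auto simp: complex_nonpos_Reals_iff complex_eq_iff)
  then show False using exp_E_real_not_escaping assms by metis
qed

theorem proposition2p1:
  shows "\<not> topologically_conjugate_on (escaping_set exp_E) exp_E
           (escaping_set exp_E_tilde) exp_E_tilde"
proof
  let ?I = "escaping_set exp_E" and ?J = "escaping_set exp_E_tilde"
  assume "topologically_conjugate_on ?I exp_E ?J exp_E_tilde"
  then obtain \<Phi> \<Psi> where hom: "homeomorphism ?I ?J \<Phi> \<Psi>"
    and conj: "\<And>z. z \<in> ?I \<Longrightarrow> \<Phi> (exp_E z) = exp_E_tilde (\<Phi> z)"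
    unfolding topologically_conjugate_on_def by blast
  have \<Psi>: "\<Psi> z \<in> ?I" "\<Phi> (\<Psi> z) = z" if "z \<in> ?J" for z
    using hom that unfolding homeomorphism_def by auto
  have branch: "exp_E (Ln (z + 2)) = z" "Ln (z + 2) \<in> ?I" if "z \<in> ?I" for z
  proof -
    have "z + 2 \<noteq> 0" using escaping_exp_E_plus_2_notin_nonpos_Reals[OF that] by force
    then show *: "exp_E (Ln (z + 2)) = z" by (simp add: exp_E_def)
    show "Ln (z + 2) \<in> ?I" using image_in_escaping_set_iff[of exp_E "Ln (z + 2)"] * that by simp
  qed
  \<comment> \<open>The principal branch on \<open>?I\<close>, transported by the conjugacy, inverts
    \<open>exp_E_tilde\<close> from the right on \<open>?J\<close>.\<close>
  define s where "s z = \<Phi> (Ln (\<Psi> z + 2))" for z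
  have "continuous_on ?J s"
    unfolding s_def
  proof (rule continuous_on_compose2[OF homeomorphism_cont1[OF hom]])
    show "continuous_on ?J (\<lambda>z. Ln (\<Psi> z + 2))"
      using escaping_exp_E_plus_2_notin_nonpos_Reals \<Psi>(1)
      by (intro continuous_intros homeomorphism_cont2[OF hom]) auto
  qed (use branch(2) \<Psi>(1) in auto)
  moreover have "exp (s z) = z - sv" if "z \<in> ?J" for z
  proof -
    have "exp_E_tilde (s z) = z"
      unfolding s_def using conj branch \<Psi> that by metis
    then show ?thesis by (simp add: exp_E_tilde_eq eq_diff_eq)
  qed
  ultimately show False
    using no_continuous_log_around_singleton_component connected_component_sv by blast
qed

end
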